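(* For any integer $n\geq 3$, the map $d_n\colon(\mathbb{R}^2)^n\to[0,+\infty[$ that associates with any $(x_1,\ldots,x_n)\in(\mathbb{R}^2)^n$ the cardinality of the set $$\Delta=\big\{\overline{x_ix_j}\mid i,j\in\{1,\ldots,n\}\text{ and }x_i\neq x_j\big\}$$ is an $n$-distance on $\mathbb{R}^2$ whose best constant $K_n^*$ satisfies $$\frac{1}{n-2+\frac{2}{n}}\leq K_n^*<\frac{1}{n-2}.$$
   Context: For distinct $x,y\in\mathbb{R}^2$, $\overline{xy}$ denotes the direction $\pm(x-y)/\|x-y\|$ (unit vector up to sign, Euclidean norm), so that $\overline{xy}$ and $\overline{yx}$ represent the same direction. For a function $f\colon X^n\to[0,+\infty[$, $f(x_1,\ldots,x_n)_i^z$ denotes the value of $f$ at $(x_1,\ldots,x_{i-1},z,x_{i+1},\ldots,x_n)$. An $n$-distance on a nonempty set $X$ is a function $f\colon X^n\to[0,+\infty[$ such that: (i) $f(x_1,\ldots,x_n)\leq\sum_{i=1}^n f(x_1,\ldots,x_n)_i^z$ for all $x_1,\ldots,x_n,z\in X$; (ii) $f$ is invariant under all permutations of its arguments; (iii) $f(x_1,\ldots,x_n)=0$ if and only if $x_1=\cdots=x_n$. The best constant $K_n^*$ associated with an $n$-distance $f$ is the infimum of the set of real numbers $K\in\,]0,1]$ such that $f(x_1,\ldots,x_n)\leq K\sum_{i=1}^n f(x_1,\ldots,x_n)_i^z$ for all $x_1,\ldots,x_n,z\in X$. *)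

theory Defs
  imports "HOL-Analysis.Analysis" "HOL-Combinatorics.Permutations"
begin

text \<open>An element of \<open>X\<^sup>n\<close> is a list of length \<open>n\<close> with entries in \<open>X\<close>, indexed from \<open>0\<close>;
  \<open>f (xs[i := z])\<close> is the value of \<open>f\<close> at the tuple whose \<open>i\<close>-th entry is replaced by \<open>z\<close>.
  Values of \<open>f\<close> outside \<open>X\<^sup>n\<close> are irrelevant.\<close>

definition tuples :: "nat \<Rightarrow> 'a set \<Rightarrow> 'a list set" where
  "tuples n X = {xs. length xs = n \<and> set xs \<subseteq> X}"

definition n_distance :: "nat \<Rightarrow> 'a set \<Rightarrow> ('a list \<Rightarrow> real) \<Rightarrow> bool" where
  "n_distance n X f \<longleftrightarrow>
     X \<noteq> {} \<and>
     (\<forall>xs\<in>tuples n X. 0 \<le> f xs) \<and>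
     (\<forall>xs\<in>tuples n X. \<forall>z\<in>X. f xs \<le> (\<Sum>i<n. f (xs[i := z]))) \<and>
     (\<forall>xs\<in>tuples n X. \<forall>p. p permutes {..<n} \<longrightarrow> f (permute_list p xs) = f xs) \<and>
     (\<forall>xs\<in>tuples n X. f xs = 0 \<longleftrightarrow> (\<forall>i<n. \<forall>j<n. xs ! i = xs ! j))"

definition best_constant :: "nat \<Rightarrow> 'a set \<Rightarrow> ('a list \<Rightarrow> real) \<Rightarrow> real" where
  "best_constant n X f =
     Inf {K. 0 < K \<and> K \<le> 1 \<and>
             (\<forall>xs\<in>tuples n X. \<forall>z\<in>X. f xs \<le> K * (\<Sum>i<n. f (xs[i := z])))}"

text \<open>A unit vector up to sign is represented by the set of its two signed versions.\<close>

definition direction :: "real^2 \<Rightarrow> real^2 \<Rightarrow> (real^2) set" where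
  "direction x y = {(x - y) /\<^sub>R norm (x - y), - ((x - y) /\<^sub>R norm (x - y))}"

definition directions :: "nat \<Rightarrow> (real^2) list \<Rightarrow> (real^2) set set" where
  "directions n xs = {direction (xs ! i) (xs ! j) | i j. i < n \<and> j < n \<and> xs ! i \<noteq> xs ! j}"

definition direction_distance :: "nat \<Rightarrow> (real^2) list \<Rightarrow> real" where
  "direction_distance n xs = real (card (directions n xs))"

end

theory Submission
  imports Defs
begin

text \<open>
  Fix points \<open>x\<^sub>1, \<dots>, x\<^sub>n\<close>, let \<open>m\<close> be their number of directions and let \<open>\<Delta>\<^sub>i\<close> be the set
  of directions after the \<open>i\<close>-th point has been replaced by \<open>z\<close>. Everything rests on a double
  count of the pairs \<open>(i, d)\<close> with \<open>d \<in> \<Delta>\<^sub>i\<close>.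

  \<^emph>\<open>Upper bound.\<close> A direction spanned by \<open>x\<^sub>a\<close> and \<open>x\<^sub>b\<close> survives every replacement with
  \<open>i \<notin> {a, b}\<close>, so the sum of the \<open>card \<Delta>\<^sub>i\<close> is at least \<open>(n - 2) m\<close>. This already gives
  the simplex inequality. One more incidence can always be found if \<open>m > 0\<close>: some \<open>x\<^sub>j\<close> differs from
  \<open>z\<close>, and the direction through \<open>z\<close> and \<open>x\<^sub>j\<close> belongs to \<open>\<Delta>\<^sub>i\<close> for all \<open>i \<noteq> j\<close>. Whether or not
  this direction was among the original ones, the sum is at least \<open>(n - 2) m + 1\<close>
  (\<open>sum_card_dirs_update\<close>). Because \<open>m\<close> is at most \<open>n choose 2\<close>, this additive gain is
  a multiplicative one: the constant \<open>1 / (n - 2 + 1 / (n choose 2))\<close> is admissible, and it is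
  smaller than \<open>1 / (n - 2)\<close>.

  \<^emph>\<open>Lower bound.\<close> Take \<open>n\<close> points whose \<open>n choose 2\<close> directions are pairwise different, and
  let \<open>z\<close> be one of them. Replacing \<open>z\<close> by itself changes nothing, and every other replacement
  leaves only \<open>n - 1\<close> points, hence at most \<open>(n - 1) choose 2\<close> directions. The quotient of the
  two sides is then at least \<open>1 / (n - 2 + 2 / n)\<close>. Suitable points lie on a parabola
  (\<open>card_dirs_parabola\<close>): the chord between the abscissae \<open>s\<close> and \<open>t\<close> has slope \<open>s + t\<close>, and the
  powers of two have pairwise different sums.
\<close>

section \<open>Directions spanned by a set of points\<close>

definition dirs :: "(real^2) set \<Rightarrow> (real^2) set set" where
  "dirs S = {direction x y | x y. x \<in> S \<and> y \<in> S \<and> x \<noteq> y}"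

text \<open>The directions of a tuple depend only on the set of its entries; in particular they are
  insensitive to permutations and repetitions.\<close>

lemma directions_eq_dirs:
  assumes "length xs = n"
  shows "directions n xs = dirs (set xs)"
  using assms unfolding directions_def dirs_def set_conv_nth by blast

lemma dirsI: "x \<in> S \<Longrightarrow> y \<in> S \<Longrightarrow> x \<noteq> y \<Longrightarrow> direction x y \<in> dirs S"
  by (auto simp: dirs_def)

text \<open>The direction as a function of the unordered pair of points, so that directions can be
  counted through two-element subsets.\<close>

definition pair_direction :: "(real^2) set \<Rightarrow> (real^2) set" where
  "pair_direction P = {(x - y) /\<^sub>R norm (x - y) | x y. x \<in> P \<and> y \<in> P \<and> x \<noteq> y}"

lemma pair_direction_pair:
  assumes "x \<noteq> y"
  shows "pair_direction {x, y} = direction x y"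
proof -
  have "(y - x) /\<^sub>R norm (y - x) = - ((x - y) /\<^sub>R norm (x - y))"
    by (metis minus_diff_eq norm_minus_commute scaleR_minus_right)
  moreover have "pair_direction {x, y} = {(x - y) /\<^sub>R norm (x - y), (y - x) /\<^sub>R norm (y - x)}"
    using assms unfolding pair_direction_def by blast
  ultimately show ?thesis
    by (simp add: direction_def)
qed

lemma dirs_eq_image: "dirs S = pair_direction ` {P. P \<subseteq> S \<and> card P = 2}"
proof
  show "dirs S \<subseteq> pair_direction ` {P. P \<subseteq> S \<and> card P = 2}"
  proof
    fix d assume "d \<in> dirs S"
    then obtain x y where "x \<in> S" "y \<in> S" "x \<noteq> y" "d = direction x y"
      unfolding dirs_def by blast
    then show "d \<in> pair_direction ` {P. P \<subseteq> S \<and> card P = 2}"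
      by (intro image_eqI[where x = "{x, y}"]) (auto simp: pair_direction_pair)
  qed
  show "pair_direction ` {P. P \<subseteq> S \<and> card P = 2} \<subseteq> dirs S"
    by (auto simp: card_2_iff pair_direction_pair intro!: dirsI)
qed

lemma finite_dirs: "finite S \<Longrightarrow> finite (dirs S)"
  by (simp add: dirs_eq_image)

lemma card_dirs_le:
  assumes "finite S"
  shows "card (dirs S) \<le> card S choose 2"
proof -
  have "finite {P. P \<subseteq> S \<and> card P = 2}"
    using assms by simp
  then have "card (dirs S) \<le> card {P. P \<subseteq> S \<and> card P = 2}"
    unfolding dirs_eq_image by (rule card_image_le)
  also have "\<dots> = card S choose 2"
    by (rule n_subsets[OF assms])
  finally show ?thesis .
qed

section \<open>Counting directions over all replacements\<close>

text \<open>Only the directions of \<open>xs\<close> and one direction \<open>e\<close> through \<open>z\<close> are counted. Each of the former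
  occurs in at least \<open>n - 2\<close> of the modified tuples and \<open>e\<close> in at least \<open>n - 1\<close>; the summand \<open>1\<close>
  is the excess of \<open>e\<close> if \<open>e\<close> is old, and part of its whole contribution if it is new.\<close>

lemma sum_card_dirs_update:
  assumes len: "length xs = n" and n: "n \<ge> 2" and ne: "dirs (set xs) \<noteq> {}"
  shows "(n - 2) * card (dirs (set xs)) + 1 \<le> (\<Sum>i<n. card (dirs (set (xs[i := z]))))"
proof -
  define D where "D = dirs (set xs)"
  define D' where "D' i = dirs (set (xs[i := z]))" for i
  have fin: "finite D" "finite (D' i)" for i
    by (simp_all add: D_def D'_def finite_dirs)
  have old: "xs ! a \<in> set (xs[i := z])" if "a < n" "i \<noteq> a" for a i
    using that len by (metis length_list_update nth_list_update_neq nth_mem)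
  have new: "z \<in> set (xs[i := z])" if "i < n" for i
    using that len by (simp add: set_update_memI)

  obtain x y where "x \<in> set xs" "y \<in> set xs" "x \<noteq> y"
    using ne unfolding dirs_def by blast
  then obtain w where "w \<in> set xs" "w \<noteq> z"
    by blast
  then obtain j where j: "j < n" "xs ! j \<noteq> z"
    by (auto simp: in_set_conv_nth len)
  define e where "e = direction z (xs ! j)"

  define N where "N d = card {i. i < n \<and> d \<in> D' i}" for d
  have N_old: "n - 2 \<le> N d" if "d \<in> D" for d
  proof -
    have "d \<in> directions n xs"
      using that by (simp add: D_def directions_eq_dirs[OF len])
    then obtain a b where ab: "a < n" "b < n" "xs ! a \<noteq> xs ! b" "d = direction (xs ! a) (xs ! b)"
      unfolding directions_def by blast
    have "{..<n} - {a, b} \<subseteq> {i. i < n \<and> d \<in> D' i}"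
      using ab old by (auto simp: D'_def intro!: dirsI)
    then have "card ({..<n} - {a, b}) \<le> N d"
      unfolding N_def by (intro card_mono) auto
    moreover have "n - card {a, b} \<le> card ({..<n} - {a, b})"
      using diff_card_le_card_Diff[of "{a, b}" "{..<n}"] by simp
    moreover have "card {a, b} = 2"
      using ab by (auto simp: card_2_iff)
    ultimately show ?thesis by simp
  qed
  have N_new: "n - 1 \<le> N e"
  proof -
    have "{..<n} - {j} \<subseteq> {i. i < n \<and> e \<in> D' i}"
      using j old new by (auto simp: D'_def e_def intro!: dirsI)
    then have "card ({..<n} - {j}) \<le> N e"
      unfolding N_def by (intro card_mono) auto
    then show ?thesis using j by simp
  qed

  have "(n - 2) * card D + 1 \<le> (\<Sum>d\<in>insert e D. N d)"
  proof -
    have "(n - 2) * card (D - {e}) \<le> (\<Sum>d\<in>D - {e}. N d)"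
      using sum_bounded_below[of "D - {e}" "n - 2" N] N_old by (simp add: mult.commute)
    moreover have "(\<Sum>d\<in>insert e D. N d) = N e + (\<Sum>d\<in>D - {e}. N d)"
      using fin by (simp add: sum.insert_remove)
    moreover have "card D \<le> card (D - {e}) + 1"
      using diff_card_le_card_Diff[of "{e}" D] by simp
    then have "(n - 2) * card D \<le> (n - 2) * (card (D - {e}) + 1)"
      by (rule mult_le_mono2)
    then have "(n - 2) * card D \<le> (n - 2) * card (D - {e}) + (n - 2)"
      by simp
    ultimately show ?thesis
      using N_new n by linarith
  qed
  also have "\<dots> = (\<Sum>d\<in>insert e D. \<Sum>i<n. if d \<in> D' i then 1 else 0)"
    unfolding N_def by (simp add: sum.If_cases lessThan_def Int_def)
  also have "\<dots> = (\<Sum>i<n. \<Sum>d\<in>insert e D. if d \<in> D' i then 1 else 0)"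
    by (rule sum.swap)
  also have "\<dots> = (\<Sum>i<n. card (insert e D \<inter> D' i))"
    using fin by (intro sum.cong refl) (simp only: sum.If_cases finite_insert Collect_mem_eq, simp)
  also have "\<dots> \<le> (\<Sum>i<n. card (D' i))"
    using fin by (intro sum_mono card_mono) auto
  finally show ?thesis
    by (simp add: D_def D'_def)
qed

lemma direction_distance_eq:
  "xs \<in> tuples n UNIV \<Longrightarrow> direction_distance n xs = real (card (dirs (set xs)))"
  by (simp add: direction_distance_def directions_eq_dirs tuples_def)

lemma update_in_tuples: "xs \<in> tuples n UNIV \<Longrightarrow> xs[i := z] \<in> tuples n UNIV"
  by (simp add: tuples_def)

text \<open>The bound \<open>n choose 2\<close> on the number \<open>m\<close> of directions turns the gain \<open>1\<close> of the incidence count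
  into the gain \<open>m / (n choose 2)\<close>, which is proportional to \<open>m\<close>.\<close>

lemma direction_distance_sum_ge:
  assumes "n \<ge> 3" and xs: "xs \<in> tuples n UNIV"
  shows "(real n - 2 + 1 / real (n choose 2)) * direction_distance n xs
    \<le> (\<Sum>i<n. direction_distance n (xs[i := z]))"
proof (cases "dirs (set xs) = {}")
  case True
  then show ?thesis
    using xs by (auto simp: direction_distance_eq update_in_tuples intro!: sum_nonneg)
next
  case False
  define m where "m = card (dirs (set xs))"
  have len: "length xs = n"
    using xs by (simp add: tuples_def)
  have "card (dirs (set xs)) \<le> card (set xs) choose 2"
    by (simp add: card_dirs_le)
  also have "\<dots> \<le> n choose 2"
    using card_length[of xs] len by (auto intro: binomial_right_mono)
  finally have "real m / real (n choose 2) \<le> 1"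
    by (simp add: m_def divide_le_eq)
  moreover have "real ((n - 2) * m + 1) \<le> real (\<Sum>i<n. card (dirs (set (xs[i := z]))))"
    unfolding m_def of_nat_le_iff using sum_card_dirs_update[OF len _ False] assms by simp
  then have "(real n - 2) * real m + 1 \<le> (\<Sum>i<n. direction_distance n (xs[i := z]))"
    using assms by (simp add: direction_distance_eq update_in_tuples of_nat_diff)
  ultimately show ?thesis
    using xs by (simp add: direction_distance_eq m_def algebra_simps)
qed

lemma n_distance_direction_distance:
  assumes "n \<ge> 3"
  shows "n_distance n UNIV (direction_distance n)"
  unfolding n_distance_def
proof (intro conjI ballI allI impI)
  fix xs :: "(real^2) list" and z
  assume xs: "xs \<in> tuples n UNIV"
  have "1 * direction_distance n xs \<le>
      (real n - 2 + 1 / real (n choose 2)) * direction_distance n xs"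
    using assms by (intro mult_right_mono) (auto simp: direction_distance_def add_increasing2)
  also have "\<dots> \<le> (\<Sum>i<n. direction_distance n (xs[i := z]))"
    by (rule direction_distance_sum_ge[OF assms xs])
  finally show "direction_distance n xs \<le> (\<Sum>i<n. direction_distance n (xs[i := z]))"
    by simp
next
  fix xs :: "(real^2) list" and p
  assume "xs \<in> tuples n UNIV" "p permutes {..<n}"
  then show "direction_distance n (permute_list p xs) = direction_distance n xs"
    by (simp add: direction_distance_def directions_eq_dirs tuples_def)
next
  fix xs :: "(real^2) list"
  assume "xs \<in> tuples n UNIV"
  then have "finite (directions n xs)"
    by (simp add: directions_eq_dirs finite_dirs tuples_def)
  then have "direction_distance n xs = 0 \<longleftrightarrow> directions n xs = {}"
    by (simp add: direction_distance_def)
  also have "\<dots> \<longleftrightarrow> (\<forall>i<n. \<forall>j<n. xs ! i = xs ! j)"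
    unfolding directions_def by blast
  finally show "direction_distance n xs = 0 \<longleftrightarrow> (\<forall>i<n. \<forall>j<n. xs ! i = xs ! j)" .
qed (simp_all add: direction_distance_def)

section \<open>Points with pairwise different directions\<close>

text \<open>Equal directions are represented by parallel vectors, which is used here as the vanishing of the
  two-by-two determinant.\<close>

lemma direction_eq_imp_parallel:
  assumes "direction x y = direction u v"
  shows "(x - y) $ 1 * (u - v) $ 2 = (x - y) $ 2 * (u - v) $ 1"
proof (cases "x = y \<or> u = v")
  case True
  then show ?thesis by auto
next
  case False
  define a where "a = norm (x - y)"
  define b where "b = norm (u - v)"
  have pos: "a > 0" "b > 0"
    using False by (auto simp: a_def b_def)
  have "(x - y) /\<^sub>R a \<in> direction u v"
    using assms by (auto simp: direction_def a_def)
  then have "(x - y) /\<^sub>R a = (u - v) /\<^sub>R b \<or> (x - y) /\<^sub>R a = - ((u - v) /\<^sub>R b)"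
    by (simp add: direction_def b_def)
  then obtain c where "x - y = c *\<^sub>R (u - v)"
  proof
    assume h: "(x - y) /\<^sub>R a = (u - v) /\<^sub>R b"
    have "x - y = a *\<^sub>R ((x - y) /\<^sub>R a)"
      using pos by simp
    then have "x - y = (a / b) *\<^sub>R (u - v)"
      unfolding h by (simp add: divide_inverse)
    then show thesis by (rule that)
  next
    assume h: "(x - y) /\<^sub>R a = - ((u - v) /\<^sub>R b)"
    have "x - y = a *\<^sub>R ((x - y) /\<^sub>R a)"
      using pos by simp
    then have "x - y = (- (a / b)) *\<^sub>R (u - v)"
      unfolding h by (simp add: divide_inverse)
    then show thesis by (rule that)
  qed
  then show ?thesis
    by (simp only: vector_scaleR_component) (simp add: mult_ac)
qed

lemma sum_powers_of_two_unique:
  fixes i j k l :: nat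
  assumes "i \<noteq> j" "k \<noteq> l" "(2::nat) ^ i + 2 ^ j = 2 ^ k + 2 ^ l"
  shows "{i, j} = {k, l}"
proof -
  \<comment> \<open>The larger exponent is determined by the sum, since the sum lies strictly between two consecutive
     powers of two.\<close>
  have top: "b \<ge> d" if "a < b" "c < d" "(2::nat) ^ a + 2 ^ b = 2 ^ c + 2 ^ d" for a b c d :: nat
  proof (rule ccontr)
    assume "\<not> d \<le> b"
    then have "(2::nat) ^ Suc b \<le> 2 ^ d"
      by (intro power_increasing) auto
    moreover have "(2::nat) ^ a < 2 ^ b"
      using that by simp
    ultimately show False
      using that by simp
  qed
  have ordered: "a = c \<and> b = d" if "a < b" "c < d" "(2::nat) ^ a + 2 ^ b = 2 ^ c + 2 ^ d"
    for a b c d :: nat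
  proof -
    have "b = d"
      using top[OF that] top[OF that(2,1) that(3)[symmetric]] by simp
    then show ?thesis using that by simp
  qed
  show ?thesis
    using assms ordered[of i j k l] ordered[of i j l k] ordered[of j i k l] ordered[of j i l k]
    by (auto simp: add.commute linorder_neq_iff)
qed

definition parabola_point :: "nat \<Rightarrow> real^2" where
  "parabola_point i = vector [2 ^ i, (2 ^ i)\<^sup>2]"

lemma inj_parabola_point: "inj parabola_point"
proof (rule injI)
  fix i j assume "parabola_point i = parabola_point j"
  then have "parabola_point i $ 1 = parabola_point j $ 1" by simp
  then show "i = j" by (simp add: parabola_point_def)
qed

lemma parabola_direction_unique:
  assumes "i \<noteq> j" "k \<noteq> l"
    and "direction (parabola_point i) (parabola_point j) =
         direction (parabola_point k) (parabola_point l)"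
  shows "{i, j} = {k, l}"
proof -
  define s t u v :: real where "s = 2 ^ i" "t = 2 ^ j" "u = 2 ^ k" "v = 2 ^ l"
  note st = this
  have "(s - t) * (u\<^sup>2 - v\<^sup>2) = (s\<^sup>2 - t\<^sup>2) * (u - v)"
    using direction_eq_imp_parallel[OF assms(3)] by (simp add: parabola_point_def st)
  then have "(s - t) * (u - v) * (s + t) = (s - t) * (u - v) * (u + v)"
    by (simp add: power2_eq_square algebra_simps)
  moreover have "s \<noteq> t" "u \<noteq> v"
    using assms by (simp_all add: st)
  ultimately have "s + t = u + v"
    by simp
  then have "real (2 ^ i + 2 ^ j) = real (2 ^ k + 2 ^ l)"
    by (simp add: st)
  then have "(2::nat) ^ i + 2 ^ j = 2 ^ k + 2 ^ l"
    by (simp only: of_nat_eq_iff)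
  then show ?thesis
    using assms sum_powers_of_two_unique by blast
qed

lemma card_dirs_parabola:
  assumes "finite I"
  shows "card (dirs (parabola_point ` I)) = card I choose 2"
proof -
  let ?S = "parabola_point ` I"
  have "inj_on pair_direction {P. P \<subseteq> ?S \<and> card P = 2}"
  proof (rule inj_onI)
    fix P Q
    assume P: "P \<in> {P. P \<subseteq> ?S \<and> card P = 2}" and Q: "Q \<in> {P. P \<subseteq> ?S \<and> card P = 2}"
      and eq: "pair_direction P = pair_direction Q"
    from P obtain i j where i: "P = {parabola_point i, parabola_point j}"
        "parabola_point i \<noteq> parabola_point j"
      by (auto simp: card_2_iff)
    from Q obtain k l where k: "Q = {parabola_point k, parabola_point l}"
        "parabola_point k \<noteq> parabola_point l"
      by (auto simp: card_2_iff)
    have "i \<noteq> j" "k \<noteq> l"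
      using i k by auto
    then have "{i, j} = {k, l}"
      using eq i k by (intro parabola_direction_unique) (simp_all add: pair_direction_pair)
    then have "parabola_point ` {i, j} = parabola_point ` {k, l}"
      by (rule arg_cong)
    then show "P = Q"
      using i k by simp
  qed
  then have "card (dirs ?S) = card ?S choose 2"
    using assms by (simp add: dirs_eq_image card_image n_subsets)
  then show ?thesis
    using card_image[OF inj_on_subset[OF inj_parabola_point subset_UNIV], of I] by simp
qed

section \<open>The best constant\<close>

text \<open>Replacing the first point by itself keeps all \<open>n choose 2\<close> directions. Each of the other \<open>n - 1\<close>
  replacements duplicates the first point and so leaves at most \<open>(n - 1) choose 2\<close> of them; the
  total, divided by \<open>n choose 2\<close>, is at most \<open>1 + (n - 1) (n - 2) / n = n - 2 + 2 / n\<close>.\<close>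

lemma direction_distance_extremal:
  fixes n :: nat
  assumes "n \<ge> 3"
  defines "xs \<equiv> map parabola_point [0..<n]"
  shows "direction_distance n xs = real n * (real n - 1) / 2" (is ?dist)
    and "(\<Sum>i<n. direction_distance n (xs[i := xs ! 0]))
      \<le> (real n - 2 + 2 / real n) * direction_distance n xs" (is ?sum)
proof -
  have len: "length xs = n"
    by (simp add: xs_def)
  then have tup: "xs \<in> tuples n UNIV"
    by (simp add: tuples_def)
  have set_xs: "set xs = parabola_point ` {..<n}"
    by (auto simp: xs_def)
  have dist_xs: "distinct xs"
    using inj_parabola_point by (auto simp: xs_def distinct_map intro: inj_on_subset)
  have choose2: "real (k choose 2) = real k * (real k - 1) / 2" for k
    by (cases k) (simp_all add: choose_two real_of_nat_div algebra_simps)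
  show dist: ?dist
    using tup choose2[of n] by (simp add: direction_distance_eq set_xs card_dirs_parabola)
  have le: "direction_distance n (xs[i := xs ! 0]) \<le> (real n - 1) * (real n - 2) / 2"
    if i: "i \<in> {1..<n}" for i
  proof -
    have "set (xs[i := xs ! 0]) \<subseteq> set xs - {xs ! i}"
    proof
      fix p assume "p \<in> set (xs[i := xs ! 0])"
      then obtain k where k: "k < n" "p = xs[i := xs ! 0] ! k"
        by (metis in_set_conv_nth len length_list_update)
      then show "p \<in> set xs - {xs ! i}"
        using i len dist_xs by (cases "k = i") (auto simp: nth_eq_iff_index_eq)
    qed
    then have "card (set (xs[i := xs ! 0])) \<le> card (set xs - {xs ! i})"
      by (intro card_mono) auto
    also have "\<dots> = n - 1"
      using i len dist_xs by (simp add: distinct_card)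
    finally have "card (set (xs[i := xs ! 0])) choose 2 \<le> (n - 1) choose 2"
      by (rule binomial_right_mono)
    then have "card (dirs (set (xs[i := xs ! 0]))) \<le> (n - 1) choose 2"
      using card_dirs_le[of "set (xs[i := xs ! 0])"] by simp
    then have "direction_distance n (xs[i := xs ! 0]) \<le> real ((n - 1) choose 2)"
      using tup by (simp add: direction_distance_eq update_in_tuples)
    then show ?thesis
      using assms(1) by (simp add: choose2 of_nat_diff)
  qed
  have "(\<Sum>i<n. direction_distance n (xs[i := xs ! 0]))
      = direction_distance n (xs[0 := xs ! 0])
        + (\<Sum>i\<in>{1..<n}. direction_distance n (xs[i := xs ! 0]))"
    using assms(1) by (simp add: lessThan_atLeast0 sum.atLeast_Suc_lessThan)
  also have "\<dots> \<le> real n * (real n - 1) / 2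
      + real (n - 1) * ((real n - 1) * (real n - 2) / 2)"
  proof (rule add_mono)
    show "direction_distance n (xs[0 := xs ! 0]) \<le> real n * (real n - 1) / 2"
      using dist by simp
    show "(\<Sum>i\<in>{1..<n}. direction_distance n (xs[i := xs ! 0]))
        \<le> real (n - 1) * ((real n - 1) * (real n - 2) / 2)"
      by (rule order_trans[OF sum_bounded_above[OF le]]) simp_all
  qed
  also have "\<dots> = (real n - 2 + 2 / real n) * direction_distance n xs"
    unfolding dist using assms(1) by (simp add: of_nat_diff field_simps)
  finally show ?sum .
qed

theorem proposition4p5:
  fixes n :: nat
  assumes "n \<ge> 3"
  shows "n_distance n UNIV (direction_distance n) \<and>
         1 / (real n - 2 + 2 / real n) \<le> best_constant n UNIV (direction_distance n) \<and>
         best_constant n UNIV (direction_distance n) < 1 / (real n - 2)"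
proof (intro conjI)
  show "n_distance n UNIV (direction_distance n)"
    by (rule n_distance_direction_distance[OF assms])
next
  let ?A = "{K. 0 < K \<and> K \<le> 1 \<and> (\<forall>xs\<in>tuples n UNIV. \<forall>z\<in>UNIV.
      direction_distance n xs \<le> K * (\<Sum>i<n. direction_distance n (xs[i := z])))}"
  define g where "g = real n - 2 + 1 / real (n choose 2)"
  have g: "real n - 2 < g" "1 \<le> g"
    using assms by (auto simp: g_def add_increasing2)
  have "g * direction_distance n xs \<le> (\<Sum>i<n. direction_distance n (xs[i := z]))"
    if "xs \<in> tuples n UNIV" for xs z
    unfolding g_def by (rule direction_distance_sum_ge[OF assms that])
  then have mem: "1 / g \<in> ?A"
    using g by (simp add: pos_le_divide_eq mult.commute)

  have "best_constant n UNIV (direction_distance n) \<le> 1 / g"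
    unfolding best_constant_def
    by (intro cInf_lower[OF mem] bdd_belowI[where m = 0]) auto
  also have "\<dots> < 1 / (real n - 2)"
    using g assms by (intro divide_strict_left_mono) auto
  finally show "best_constant n UNIV (direction_distance n) < 1 / (real n - 2)" .

  show "1 / (real n - 2 + 2 / real n) \<le> best_constant n UNIV (direction_distance n)"
    unfolding best_constant_def
  proof (rule cInf_greatest)
    show "?A \<noteq> {}"
      using mem by blast
  next
    fix K assume K: "K \<in> ?A"
    define xs where "xs = map parabola_point [0..<n]"
    have tup: "xs \<in> tuples n UNIV"
      by (simp add: xs_def tuples_def)
    have pos: "direction_distance n xs > 0"
      unfolding xs_def direction_distance_extremal(1)[OF assms] using assms by simp
    have "direction_distance n xs \<le> K * (\<Sum>i<n. direction_distance n (xs[i := xs ! 0]))"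
      using K tup by blast
    also have "\<dots> \<le> K * ((real n - 2 + 2 / real n) * direction_distance n xs)"
      using K direction_distance_extremal(2)[OF assms] by (intro mult_left_mono) (auto simp: xs_def)
    finally have "1 * direction_distance n xs
        \<le> (K * (real n - 2 + 2 / real n)) * direction_distance n xs"
      by (simp only: mult.assoc mult_1)
    then have "1 \<le> K * (real n - 2 + 2 / real n)"
      using pos by (simp only: mult_le_cancel_right_pos)
    moreover have "real n - 2 + 2 / real n > 0"
      using assms by (intro add_pos_pos) auto
    ultimately show "1 / (real n - 2 + 2 / real n) \<le> K"
      by (simp only: pos_divide_le_eq)
  qed
qed

end
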